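(* Let $G$ be a finite, simple cactus graph. Then $$\mathrm{Sz}(G) \leq 2\, W(G),$$ with equality if and only if every block of $G$ is a cycle of even length.
   Context: A cactus graph is a connected graph in which every two distinct cycles have at most one common vertex; alternatively, it is a connected graph that consists of a single vertex, or in which every block is either an edge or a cycle. A block is a maximal 2-connected subgraph in the sense of the block-cut-vertex decomposition, in which blocks only overlap at cut vertices; a block may consist of a single edge with its two end points. $V(G)$ and $E(G)$ are the vertex and edge sets of $G$; $d_G(u,v)$ is the length of a shortest path between $u$ and $v$ in $G$. The Wiener index is $$W(G) = \sum_{\{u,v\} \subseteq V(G)} d_G(u,v) = \tfrac12 \sum_{u,v \in V(G)} d_G(u,v).$$ For vertices $s,t$, $n_G(s,t)$ is the number of vertices $w$ of $G$ that are closer to $s$ than to $t$, i.e. with $d_G(w,s) < d_G(w,t)$. The Szeged index is $$\mathrm{Sz}(G) = \sum_{\{s,t\} \in E(G)} n_G(s,t)\, n_G(t,s).$$ *)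

theory Defs
  imports Complex_Main "Graph_Theory.Graph_Theory"
begin

text \<open>
  A finite simple graph is a digraph satisfying the locale \<^locale>\<open>graph\<close>: finite, loop-free,
  without parallel arcs, and symmetric. An undirected edge \<open>{s, t}\<close> is thus represented by the two
  ordered pairs \<open>(s, t)\<close> and \<open>(t, s)\<close> in \<open>arcs_ends G\<close>.
\<close>

definition graph_dist :: "('a, 'b) pre_digraph \<Rightarrow> 'a \<Rightarrow> 'a \<Rightarrow> nat" where
  "graph_dist G u v = (LEAST n. \<exists>p. pre_digraph.apath G u p v \<and> length p = n)"

definition wiener_index :: "('a, 'b) pre_digraph \<Rightarrow> real" where
  "wiener_index G = (\<Sum>u\<in>verts G. \<Sum>v\<in>verts G. real (graph_dist G u v)) / 2"

definition num_closer :: "('a, 'b) pre_digraph \<Rightarrow> 'a \<Rightarrow> 'a \<Rightarrow> nat" where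
  "num_closer G s t = card {w \<in> verts G. graph_dist G w s < graph_dist G w t}"

text \<open>
  The summand below is symmetric in \<open>s\<close> and \<open>t\<close>, and each undirected edge occurs with both of
  its orientations in \<open>arcs_ends G\<close>; hence the factor one half.
\<close>

definition szeged_index :: "('a, 'b) pre_digraph \<Rightarrow> real" where
  "szeged_index G = (\<Sum>(s, t)\<in>arcs_ends G. real (num_closer G s t * num_closer G t s)) / 2"

text \<open>
  Blocks are the maximal connected subgraphs with at least two vertices and without a cut vertex of
  their own. A bridge with its two ends is a block; a graph with a single vertex has no block.
\<close>

definition nonseparable :: "('a, 'b) pre_digraph \<Rightarrow> bool" where
  "nonseparable H \<longleftrightarrow> graph H \<and> 2 \<le> card (verts H) \<and> Digraph_Component.connected H \<and>
     (\<forall>v\<in>verts H. Digraph_Component.connected (pre_digraph.del_vert H v))"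

definition is_block :: "('a, 'b) pre_digraph \<Rightarrow> ('a, 'b) pre_digraph \<Rightarrow> bool" where
  "is_block G B \<longleftrightarrow> pre_digraph.max_subgraph G nonseparable B"

definition is_edge_graph :: "('a, 'b) pre_digraph \<Rightarrow> bool" where
  "is_edge_graph H \<longleftrightarrow> graph H \<and>
     (\<exists>u v. u \<noteq> v \<and> verts H = {u, v} \<and> arcs_ends H = {(u, v), (v, u)})"

definition is_cycle_graph :: "('a, 'b) pre_digraph \<Rightarrow> bool" where
  "is_cycle_graph H \<longleftrightarrow> graph H \<and>
     (\<exists>vs. distinct vs \<and> 3 \<le> length vs \<and> verts H = set vs \<and>
       arcs_ends H = (\<Union>i<length vs. {(vs ! i, vs ! (Suc i mod length vs)),
                                     (vs ! (Suc i mod length vs), vs ! i)}))"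

definition cactus :: "('a, 'b) pre_digraph \<Rightarrow> bool" where
  "cactus G \<longleftrightarrow> Digraph_Component.connected G \<and>
     (card (verts G) = 1 \<or> (\<forall>B. is_block G B \<longrightarrow> is_edge_graph B \<or> is_cycle_graph B))"

end

theory Submission
  imports Defs
begin

text \<open>
  For vertices \<open>x\<close>, \<open>y\<close> let \<open>A x y\<close> be the set of arcs \<open>(s, t)\<close> with \<open>x\<close> closer to \<open>s\<close> and \<open>y\<close> closer
  to \<open>t\<close>. Double counting gives that the Szeged index is half the sum of \<open>card (A x y)\<close> over all ordered pairs, so the
  inequality follows from \<open>card (A x y) \<le> 2 * d x y\<close>, and equality holds iff this bound is
  always attained.

  The function \<open>d x s - d x t\<close> takes values in \<open>{-1, 0, 1}\<close>, and its total change between \<open>x\<close> and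
  \<open>y\<close>, summed over all arcs \<open>(s, t)\<close>, is at least \<open>4 * card (A x y)\<close>. Being subadditive along a
  geodesic, this sum is at most \<open>8 * d x y\<close> as soon as it is at most \<open>8\<close> for adjacent \<open>u\<close>, \<open>v\<close>.
  There it is twice the number of edges leaving the set of vertices closer to \<open>u\<close> than to \<open>v\<close>, plus the
  same with \<open>u\<close> and \<open>v\<close> exchanged. Every such edge other than \<open>uv\<close> extends by geodesics to a simple path from \<open>u\<close>
  to \<open>v\<close>, which determines the edge; in a cactus there is at most one such path besides \<open>uv\<close>
  itself, because the union of all these paths spans the block of \<open>uv\<close>.

  If the bound is attained on the edge \<open>uv\<close>, that second path exists and passes directly from the
  vertices closer to \<open>u\<close> to those closer to \<open>v\<close>, which makes the block an even cycle. Conversely,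
  if all blocks are even cycles, no vertex is equidistant from the ends of an edge (a closest one
  would yield an odd cycle), and \<open>card (A x y)\<close> grows by 2 with every step along a geodesic.
\<close>

section \<open>Distances and geodesics\<close>

text \<open>Vertex lists over a plain relation, so that paths of \<open>G\<close> and paths inside a
  block share the same lemmas. Arc walks serve only to derive the basic facts on distance.\<close>

definition simple_path :: "('a \<times> 'a) set \<Rightarrow> 'a \<Rightarrow> 'a list \<Rightarrow> 'a \<Rightarrow> bool" where
  "simple_path E u xs v \<longleftrightarrow>
     xs \<noteq> [] \<and> hd xs = u \<and> last xs = v \<and> distinct xs \<and> successively (\<lambda>x y. (x, y) \<in> E) xs"

lemma simple_path_append:
  assumes "simple_path E u xs a" "simple_path E b ys v" "(a, b) \<in> E" "set xs \<inter> set ys = {}"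
  shows "simple_path E u (xs @ ys) v"
  using assms by (auto simp: simple_path_def successively_append_iff)

lemma simple_path_rev:
  assumes "simple_path E u xs v" "sym E"
  shows "simple_path E v (rev xs) u"
proof -
  have "successively (\<lambda>x y. (y, x) \<in> E) xs"
    using assms unfolding simple_path_def by (auto intro: successively_mono[OF _ symD])
  then show ?thesis
    using assms(1) by (simp add: simple_path_def hd_rev last_rev)
qed

locale connected_graph = graph G for G :: "('a, 'b) pre_digraph" (structure) +
  assumes connected: "Digraph_Component.connected G"
begin

abbreviation E :: "('a \<times> 'a) set" where "E \<equiv> arcs_ends G"

abbreviation d :: "'a \<Rightarrow> 'a \<Rightarrow> nat" where "d \<equiv> graph_dist G"

lemma sym_E: "sym E"
  using sym_arcs by (simp add: symmetric_def)

lemma E_commute: "(x, y) \<in> E \<Longrightarrow> (y, x) \<in> E"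
  using sym_E by (rule symD)

lemma finite_E: "finite E"
  by (simp add: arcs_ends_def)

text \<open>\<open>graph_dist\<close> minimises over paths only. A walk that repeats a vertex
  contains a closed piece; cutting it out shortens the walk, so induction on the length ends at a
  path.\<close>

lemma dist_le_awalk:
  assumes "awalk u p v"
  shows "d u v \<le> length p"
  using assms
proof (induction "length p" arbitrary: p rule: less_induct)
  case less
  show ?case
  proof (cases "distinct (awalk_verts u p)")
    case True
    with less.prems have "apath u p v"
      by (simp add: apath_def)
    then show ?thesis
      unfolding graph_dist_def by (intro Least_le exI[of _ p]) simp
  next
    case False
    obtain q r s w where "p = q @ r @ s" "0 < length r" "awalk u q w" "awalk w s v"
      using awalk_not_distinct_decomp[OF less.prems False] by (elim exE conjE)
    moreover from this(3,4) have "awalk u (q @ s) v"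
      by (rule awalk_appendI)
    ultimately show ?thesis
      using less.hyps[of "q @ s"] by simp
  qed
qed

lemma dist_awalk:
  assumes "u \<in> verts G" "v \<in> verts G"
  obtains p where "awalk u p v" "length p = d u v"
proof -
  have "strongly_connected G"
    using sym_arcs connected by (rule symmetric_connected_imp_strongly_connected)
  then have "u \<rightarrow>\<^sup>* v"
    using assms by (simp add: strongly_connected_def)
  then obtain p where "apath u p v"
    by (auto simp: reachable_apath)
  then have "\<exists>n p. apath u p v \<and> length p = n"
    by auto
  then have "\<exists>p. apath u p v \<and> length p = d u v"
    unfolding graph_dist_def by (rule LeastI_ex)
  then obtain p where "apath u p v" "length p = d u v"
    by auto
  then show thesis
    by (intro that awalkI_apath)
qed

lemma awalk_reverse:
  "awalk u p v \<Longrightarrow> \<exists>q. awalk v q u \<and> length q = length p"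
proof (induction p arbitrary: u)
  case Nil
  then show ?case by (auto simp: awalk_Nil_iff)
next
  case (Cons e p)
  then have e: "e \<in> arcs G" "u = tail G e" "awalk (head G e) p v"
    by (auto simp: awalk_Cons_iff)
  then obtain q where q: "awalk v q (head G e)" "length q = length p"
    using Cons.IH by blast
  obtain e' where e': "e' \<in> arcs G" "tail G e' = head G e" "head G e' = u"
    using sym_arcs e(1,2) by (auto simp: symmetric_conv)
  then have "awalk (head G e) [e'] u"
    using arc_implies_awalk[of e'] by simp
  with q(1) have "awalk v (q @ [e']) u"
    by (rule awalk_appendI)
  with q show ?case by (intro exI[of _ "q @ [e']"]) auto
qed

lemma dist_self [simp]: "u \<in> verts G \<Longrightarrow> d u u = 0"
  using dist_le_awalk[of u "[]" u] by (simp add: awalk_Nil_iff)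

lemma dist_eq_0_iff:
  assumes "u \<in> verts G" "v \<in> verts G"
  shows "d u v = 0 \<longleftrightarrow> u = v"
proof
  obtain p where "awalk u p v" "length p = d u v"
    using assms by (rule dist_awalk)
  then show "d u v = 0 \<Longrightarrow> u = v"
    by (simp add: awalk_Nil_iff)
qed (use assms in simp)

lemma dist_commute:
  assumes "u \<in> verts G" "v \<in> verts G"
  shows "d u v = d v u"
proof -
  have "d v u \<le> d u v" if "u \<in> verts G" "v \<in> verts G" for u v
  proof -
    obtain p where "awalk u p v" "length p = d u v"
      using \<open>u \<in> verts G\<close> \<open>v \<in> verts G\<close> by (rule dist_awalk)
    moreover obtain q where "awalk v q u" "length q = length p"
      using awalk_reverse \<open>awalk u p v\<close> by blast
    ultimately show ?thesis
      using dist_le_awalk[of v q u] by simp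
  qed
  with assms show ?thesis by (simp add: le_antisym)
qed

lemma dist_triangle:
  assumes "u \<in> verts G" "v \<in> verts G" "w \<in> verts G"
  shows "d u w \<le> d u v + d v w"
proof -
  obtain p where "awalk u p v" "length p = d u v"
    using assms(1,2) by (rule dist_awalk)
  moreover obtain q where "awalk v q w" "length q = d v w"
    using assms(2,3) by (rule dist_awalk)
  ultimately show ?thesis
    using dist_le_awalk[of u "p @ q" w] awalk_appendI[of u p v q w] by simp
qed

lemma dist_adj:
  assumes "(u, v) \<in> E"
  shows "d u v = 1"
proof -
  obtain e where e: "e \<in> arcs G" "tail G e = u" "head G e = v"
    using assms by blast
  then have "d u v \<le> 1"
    using dist_le_awalk[of u "[e]" v] arc_implies_awalk[of e] by simp
  moreover have "d u v \<noteq> 0"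
    using assms adj_not_same adj_in_verts[OF assms] dist_eq_0_iff by auto
  ultimately show ?thesis by simp
qed

lemma dist_predecessor:
  assumes "u \<in> verts G" "v \<in> verts G" "u \<noteq> v"
  obtains w where "(w, v) \<in> E" "d u v = Suc (d u w)"
proof -
  obtain p where p: "awalk u p v" "length p = d u v"
    using assms(1,2) by (rule dist_awalk)
  with assms have "p \<noteq> []"
    by (auto simp: awalk_Nil_iff)
  then obtain q e where qe: "p = q @ [e]"
    by (metis rev_exhaust)
  with p have *: "awalk u q (tail G e)" "e \<in> arcs G" "head G e = v"
    by (auto simp: awalk_Cons_iff awalk_Nil_iff)
  then have E: "(tail G e, v) \<in> E"
    by (auto simp: arcs_ends_conv)
  have "d u (tail G e) \<le> length q"
    using * dist_le_awalk by blast
  moreover have "d u v \<le> d u (tail G e) + d (tail G e) v"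
    using assms E adj_in_verts by (intro dist_triangle) auto
  ultimately have "d u v = Suc (d u (tail G e))"
    using p qe dist_adj[OF E] by simp
  with E show thesis by (rule that)
qed

lemma geodesic:
  assumes "u \<in> verts G" "v \<in> verts G"
  obtains xs where "simple_path E u xs v" "length xs = Suc (d u v)"
    "\<And>w. w \<in> set xs \<Longrightarrow> w \<in> verts G \<and> d u w + d w v = d u v"
proof -
  have "\<exists>xs. simple_path E u xs v \<and> length xs = Suc (d u v) \<and>
      (\<forall>w\<in>set xs. w \<in> verts G \<and> d u w + d w v = d u v)"
    using assms(2)
  proof (induction "d u v" arbitrary: v rule: less_induct)
    case less
    show ?case
    proof (cases "u = v")
      case True
      with assms show ?thesis
        by (intro exI[of _ "[u]"]) (simp add: simple_path_def)
    next
      case False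
      obtain y where y: "(y, v) \<in> E" "d u v = Suc (d u y)"
        using assms(1) less.prems False by (rule dist_predecessor)
      have yV: "y \<in> verts G"
        using y(1) by (rule adj_in_verts)
      then obtain xs where xs: "simple_path E u xs y" "length xs = Suc (d u y)"
          "\<forall>w\<in>set xs. w \<in> verts G \<and> d u w + d w y = d u y"
        using less.hyps[of y] y(2) by auto
      have w: "d u w + d w v = d u v" if "w \<in> set xs" for w
      proof -
        have "w \<in> verts G" "d u w + d w y = d u y"
          using that xs(3) by auto
        moreover have "d w v \<le> d w y + d y v" "d u v \<le> d u w + d w v"
          using calculation(1) assms(1) less.prems yV by (auto intro: dist_triangle)
        ultimately show ?thesis
          using y dist_adj by simp
      qed
      \<comment> \<open>Each vertex of \<open>xs\<close> is at distance at most
        \<open>d u y < d u v\<close> from \<open>u\<close>.\<close>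
      have "v \<notin> set xs"
        using xs(3) y(2) by force
      then have "simple_path E u (xs @ [v]) v"
        using xs(1) y(1) by (intro simple_path_append) (auto simp: simple_path_def)
      then show ?thesis
        using xs y w less.prems by (intro exI[of _ "xs @ [v]"]) auto
    qed
  qed
  then show thesis using that by blast
qed

lemma dist_adj_le:
  assumes "(s, t) \<in> E" "w \<in> verts G"
  shows "d w s \<le> Suc (d w t)" "d s w \<le> Suc (d t w)"
proof -
  have "s \<in> verts G" "t \<in> verts G" "d s t = 1" "d t s = 1"
    using assms(1) adj_in_verts dist_adj E_commute by blast+
  then show "d w s \<le> Suc (d w t)" "d s w \<le> Suc (d t w)"
    using dist_triangle[of w t s] dist_triangle[of s t w] assms(2) by auto
qed

section \<open>Half-spaces of an edge and their boundaries\<close>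

definition closer :: "'a \<Rightarrow> 'a \<Rightarrow> 'a set" where
  "closer s t = {w \<in> verts G. d w s < d w t}"

text \<open>Only the outgoing orientation is kept, so the cardinality counts each boundary edge
  once.\<close>

definition edge_cut :: "'a set \<Rightarrow> ('a \<times> 'a) set" where
  "edge_cut X = {(s, t) \<in> E. s \<in> X \<and> t \<notin> X}"

text \<open>By the triangle inequality a geodesic from \<open>u\<close> to \<open>a\<close> stays in
  the half-space and one from \<open>b\<close> to \<open>v\<close> stays outside. Hence their
  concatenation is simple and crosses the boundary only at \<open>(a, b)\<close>. The length is
  recorded for the parity argument in the equality case.\<close>

lemma crossing_path:
  assumes uv: "(u, v) \<in> E" and ab: "(a, b) \<in> edge_cut (closer u v)" "(a, b) \<noteq> (u, v)"
  obtains xs ys where "simple_path E u (xs @ ys) v" "xs @ ys \<noteq> [u, v]"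
    "xs \<noteq> []" "last xs = a" "set xs \<subseteq> closer u v"
    "ys \<noteq> []" "hd ys = b" "set ys \<inter> closer u v = {}"
    "length (xs @ ys) = d u a + d b v + 2"
proof -
  have V: "u \<in> verts G" "v \<in> verts G" "a \<in> verts G" "b \<in> verts G"
    and abE: "(a, b) \<in> E"
    using uv ab adj_in_verts by (auto simp: edge_cut_def)
  have a: "d a u < d a v" and b: "d b v \<le> d b u"
    using ab V by (auto simp: edge_cut_def closer_def)
  obtain xs where xs: "simple_path E u xs a" "length xs = Suc (d u a)"
    and xs': "\<And>w. w \<in> set xs \<Longrightarrow> w \<in> verts G \<and> d u w + d w a = d u a"
    using V(1,3) by (rule geodesic) blast
  obtain ys where ys: "simple_path E b ys v" "length ys = Suc (d b v)"
    and ys': "\<And>w. w \<in> set ys \<Longrightarrow> w \<in> verts G \<and> d b w + d w v = d b v"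
    using V(4,2) by (rule geodesic) blast
  have 1: "set xs \<subseteq> closer u v"
  proof
    fix w assume "w \<in> set xs"
    with xs' have w: "w \<in> verts G" "d u w + d w a = d u a" by auto
    have "d a v \<le> d a w + d w v"
      using V w by (intro dist_triangle)
    then show "w \<in> closer u v"
      using a w V dist_commute[of u w] dist_commute[of w a] dist_commute[of u a]
      by (auto simp: closer_def)
  qed
  have 2: "set ys \<inter> closer u v = {}"
  proof -
    have "w \<notin> closer u v" if "w \<in> set ys" for w
    proof -
      from that ys' have w: "w \<in> verts G" "d b w + d w v = d b v" by auto
      have "d b u \<le> d b w + d w u"
        using V w by (intro dist_triangle)
      then show ?thesis
        using b w by (auto simp: closer_def)
    qed
    then show ?thesis by auto
  qed
  have "xs @ ys \<noteq> [u, v]"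
  proof
    assume eq: "xs @ ys = [u, v]"
    moreover have "xs \<noteq> []" "ys \<noteq> []"
      using xs(1) ys(1) by (simp_all add: simple_path_def)
    ultimately have "xs = [u]" "ys = [v]"
      by (auto simp: append_eq_Cons_conv)
    with xs(1) ys(1) ab(2) show False
      by (simp add: simple_path_def)
  qed
  moreover have "simple_path E u (xs @ ys) v"
    using xs(1) ys(1) abE 1 2 by (intro simple_path_append) auto
  moreover have "xs \<noteq> []" "last xs = a" "ys \<noteq> []" "hd ys = b" "length (xs @ ys) = d u a + d b v + 2"
    using xs ys by (simp_all add: simple_path_def)
  ultimately show thesis
    using that 1 2 by blast
qed

end

section \<open>Blocks of a cactus\<close>

text \<open>With at most two neighbours, a vertex entered from \<open>p\<close> offers at most one
  exit. The common end vertex prevents one list from being a proper prefix of the other.\<close>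

lemma unique_continuation:
  assumes "sym E"
    and deg: "\<And>x a b c. (x, a) \<in> E \<Longrightarrow> (x, b) \<in> E \<Longrightarrow> (x, c) \<in> E \<Longrightarrow> a = b \<or> a = c \<or> b = c"
  shows "successively (\<lambda>x y. (x, y) \<in> E) (p # x # xs) \<Longrightarrow> distinct (p # x # xs) \<Longrightarrow>
    successively (\<lambda>x y. (x, y) \<in> E) (p # x # ys) \<Longrightarrow> distinct (p # x # ys) \<Longrightarrow>
    last (x # xs) = last (x # ys) \<Longrightarrow> xs = ys"
proof (induction xs arbitrary: p x ys)
  \<comment> \<open>The first path ends at \<open>x\<close>; by distinctness the second cannot
    return to \<open>x\<close>, so it ends there too.\<close>
  case Nil
  then show ?case
    by (cases ys) (auto dest: last_in_set split: if_splits)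
next
  case (Cons z zs)
  have "ys \<noteq> []"
  proof
    assume "ys = []"
    with Cons.prems have "last (z # zs) = x" by simp
    then have "x \<in> set (z # zs)"
      by (metis last_in_set list.distinct(1))
    with Cons.prems(2) show False by simp
  qed
  then obtain z' zs' where ys: "ys = z' # zs'"
    by (cases ys) auto
  have "(x, p) \<in> E"
    using Cons.prems(1) \<open>sym E\<close> by (simp add: symD)
  then have "z = z'"
    using deg[of x p z z'] Cons.prems(1-4) ys by auto
  moreover have "zs = zs'"
    using Cons.prems ys \<open>z = z'\<close> by (intro Cons.IH[of x z zs']) auto
  ultimately show ?case
    using ys by simp
qed

text \<open>Removing the edge \<open>uv\<close> from the cycle leaves a path through all its
  vertices.\<close>

lemma cycle_graph_path:
  assumes "is_cycle_graph B" "(u, v) \<in> arcs_ends B"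
  obtains xs where "simple_path (arcs_ends B) u xs v" "set xs = verts B"
proof -
  interpret B: graph B
    using assms(1) by (simp add: is_cycle_graph_def)
  obtain vs where vs: "distinct vs" "3 \<le> length vs" "verts B = set vs"
    and arcs: "arcs_ends B = (\<Union>i<length vs. {(vs ! i, vs ! (Suc i mod length vs)),
                                     (vs ! (Suc i mod length vs), vs ! i)})"
    using assms(1) by (auto simp: is_cycle_graph_def)
  let ?n = "length vs"
  obtain i where i: "i < ?n" and
      uv: "(u, v) = (vs ! (Suc i mod ?n), vs ! i) \<or> (v, u) = (vs ! (Suc i mod ?n), vs ! i)"
    using assms(2) unfolding arcs by blast
  \<comment> \<open>This rotation starts just after position \<open>i\<close> and ends at it, so its
    ends are those of the given edge; reversal handles the other orientation.\<close>
  let ?r = "rotate (Suc i) vs"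
  have "vs \<noteq> []" using vs(2) by auto
  have step: "(?r ! k, ?r ! Suc k) \<in> arcs_ends B" if "Suc k < ?n" for k
  proof -
    have "?r ! k = vs ! ((Suc i + k) mod ?n)"
      using that by (subst nth_rotate) auto
    moreover have "?r ! Suc k = vs ! (Suc ((Suc i + k) mod ?n) mod ?n)"
      using that by (subst nth_rotate) (auto simp: mod_Suc_eq)
    moreover have "(Suc i + k) mod ?n < ?n"
      using \<open>vs \<noteq> []\<close> by simp
    ultimately show ?thesis
      unfolding arcs by (metis (no_types, lifting) UN_I insertI1 lessThan_iff)
  qed
  have "hd ?r = vs ! (Suc i mod ?n)"
    using \<open>vs \<noteq> []\<close> by (rule hd_rotate_conv_nth)
  moreover have "last ?r = vs ! i"
  proof -
    have "last ?r = ?r ! (?n - 1)"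
      using \<open>vs \<noteq> []\<close> by (subst last_conv_nth) auto
    also have "\<dots> = vs ! ((Suc i + (?n - 1)) mod ?n)"
      using \<open>vs \<noteq> []\<close> by (intro nth_rotate) simp
    also have "Suc i + (?n - 1) = i + ?n"
      using vs(2) by simp
    finally show ?thesis
      using i by simp
  qed
  ultimately have path: "simple_path (arcs_ends B) (vs ! (Suc i mod ?n)) ?r (vs ! i)"
    unfolding simple_path_def successively_conv_nth using step vs(1) \<open>vs \<noteq> []\<close> by simp
  have "sym (arcs_ends B)"
    using B.sym_arcs by (simp add: symmetric_def)
  with path have "simple_path (arcs_ends B) (vs ! i) (rev ?r) (vs ! (Suc i mod ?n))"
    by (rule simple_path_rev)
  with path uv show thesis
    using that[of ?r] that[of "rev ?r"] vs(3) by auto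
qed

lemma cycle_graph_degree:
  assumes "is_cycle_graph B" "(x, a) \<in> arcs_ends B" "(x, b) \<in> arcs_ends B" "(x, c) \<in> arcs_ends B"
  shows "a = b \<or> a = c \<or> b = c"
proof -
  obtain vs where vs: "distinct vs" "3 \<le> length vs"
    and arcs: "arcs_ends B = (\<Union>i<length vs. {(vs ! i, vs ! (Suc i mod length vs)),
                                     (vs ! (Suc i mod length vs), vs ! i)})"
    using assms(1) by (auto simp: is_cycle_graph_def)
  let ?n = "length vs"
  have mod_less: "k mod ?n < ?n" for k
    using vs(2) by (intro mod_less_divisor) linarith
  obtain j where j: "j < ?n" "x = vs ! j"
  proof -
    obtain i where "i < ?n" "x = vs ! i \<or> x = vs ! (Suc i mod ?n)"
      using assms(2) unfolding arcs by blast
    with that mod_less show thesis by auto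
  qed
  \<comment> \<open>Subtraction on naturals truncates, so the cyclic predecessor of index 0 is
    written separately.\<close>
  have "y = vs ! (Suc j mod ?n) \<or> y = vs ! (if j = 0 then ?n - 1 else j - 1)"
    if "(x, y) \<in> arcs_ends B" for y
  proof -
    obtain i where i: "i < ?n" "x = vs ! i \<and> y = vs ! (Suc i mod ?n) \<or> x = vs ! (Suc i mod ?n) \<and> y = vs ! i"
      using \<open>(x, y) \<in> arcs_ends B\<close> unfolding arcs by blast
    consider "i = j" "y = vs ! (Suc i mod ?n)" | "Suc i mod ?n = j" "y = vs ! i"
      using i j vs(1) mod_less by (metis nth_eq_iff_index_eq)
    then show ?thesis
    proof cases
      case 2
      have "i = (if j = 0 then ?n - 1 else j - 1)"
        using 2(1) i(1) by (cases "Suc i = ?n") auto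
      with 2 show ?thesis by simp
    qed simp
  qed
  from this[OF assms(2)] this[OF assms(3)] this[OF assms(4)] show ?thesis
    by auto
qed

section \<open>The union of all simple paths between the ends of an edge\<close>

context connected_graph
begin

text \<open>For an edge \<open>uv\<close> of a cactus this is the vertex set of the block containing
  it, as \<open>is_block_path_verts\<close> shows.\<close>

definition path_verts :: "'a \<Rightarrow> 'a \<Rightarrow> 'a set" where
  "path_verts u v = {w. \<exists>xs. simple_path E u xs v \<and> w \<in> set xs}"

lemma simple_path_subset_verts:
  assumes "simple_path E u xs v" "u \<in> verts G"
  shows "set xs \<subseteq> verts G"
proof
  fix w assume "w \<in> set xs"
  then obtain i where i: "i < length xs" "w = xs ! i"
    by (auto simp: in_set_conv_nth)
  show "w \<in> verts G"
  proof (cases i)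
    case 0
    with i assms show ?thesis
      by (simp add: simple_path_def hd_conv_nth)
  next
    case (Suc j)
    with i assms(1) have "(xs ! j, w) \<in> E"
      by (simp add: simple_path_def successively_conv_nth)
    then show ?thesis
      by (rule adj_in_verts)
  qed
qed

lemma simple_path_edge: "(u, v) \<in> E \<Longrightarrow> simple_path E u [u, v] v"
  using adj_not_same by (auto simp: simple_path_def)

lemma path_verts_subset: "(u, v) \<in> E \<Longrightarrow> path_verts u v \<subseteq> verts G"
  using simple_path_subset_verts adj_in_verts by (fastforce simp: path_verts_def)

lemma ends_in_path_verts: "(u, v) \<in> E \<Longrightarrow> u \<in> path_verts u v \<and> v \<in> path_verts u v"
  using simple_path_edge[of u v] by (auto simp: path_verts_def intro!: exI[of _ "[u, v]"])

lemma arcs_ends_induce: "arcs_ends (G \<restriction> W) = E \<inter> W \<times> W"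
  by (auto simp: arcs_ends_conv)

lemma graph_induce:
  assumes "W \<subseteq> verts G"
  shows "graph (G \<restriction> W)"
proof -
  have ind: "induced_subgraph (G \<restriction> W) G"
    using assms by (rule induced_induce)
  interpret W: digraph "G \<restriction> W"
    using ind by (rule digraphI_induced)
  have "symmetric (G \<restriction> W)"
    using sym_arcs ind by (rule induced_graph_imp_symmetric)
  then show ?thesis
    by (rule W.graphI)
qed

lemma reachable_induce_path:
  assumes "successively (\<lambda>x y. (x, y) \<in> E) xs" "xs \<noteq> []" "set xs \<subseteq> W"
  shows "hd xs \<rightarrow>\<^sup>*\<^bsub>G \<restriction> W\<^esub> last xs"
proof -
  interpret W: wf_digraph "G \<restriction> W" ..
  show ?thesis
    using assms
  proof (induction xs rule: induct_list012)
    case (3 x y zs)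
    then have "y \<rightarrow>\<^sup>*\<^bsub>G \<restriction> W\<^esub> last (y # zs)" "x \<rightarrow>\<^bsub>G \<restriction> W\<^esub> y"
      by (auto simp: arcs_ends_induce)
    then show ?case
      using W.adj_reachable_trans by auto
  qed auto
qed

text \<open>A vertex removed from a simple path through \<open>x\<close> lies on one side of
  \<open>x\<close> only, so \<open>x\<close> still reaches \<open>u\<close> or \<open>v\<close>
  along the other side, and \<open>u\<close>, \<open>v\<close> are adjacent. Allowing
  \<open>Z\<close> to be empty covers connectedness and the absence of cut vertices at once.\<close>

lemma connected_path_verts_minus:
  assumes uv: "(u, v) \<in> E" and Z: "Z \<subseteq> {z}"
  shows "Digraph_Component.connected (G \<restriction> (path_verts u v - Z))"
proof -
  let ?W = "path_verts u v - Z"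
  have W: "?W \<subseteq> verts G"
    using path_verts_subset[OF uv] by auto
  interpret W: graph "G \<restriction> ?W"
    using W by (rule graph_induce)
  note sym = W.symmetric_reachable'
  have ends: "u \<noteq> v"
    using uv adj_not_same by auto
  have uv': "u \<rightarrow>\<^sup>*\<^bsub>G \<restriction> ?W\<^esub> v" if "u \<notin> Z" "v \<notin> Z"
    using that uv ends_in_path_verts[OF uv] by (intro W.reachable_adjI) (auto simp: arcs_ends_induce)
  have reach: "u \<notin> Z \<and> x \<rightarrow>\<^sup>*\<^bsub>G \<restriction> ?W\<^esub> u \<or> v \<notin> Z \<and> x \<rightarrow>\<^sup>*\<^bsub>G \<restriction> ?W\<^esub> v" if "x \<in> ?W" for x
  proof -
    from that obtain xs where xs: "simple_path E u xs v" "x \<in> set xs" "x \<notin> Z"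
      by (auto simp: path_verts_def)
    then obtain ys zs where split: "xs = ys @ x # zs"
      by (auto simp: in_set_conv_decomp)
    have sub: "set xs \<subseteq> path_verts u v"
      using xs(1) by (auto simp: path_verts_def)
    have succ: "successively (\<lambda>x y. (x, y) \<in> E) (ys @ [x])" "successively (\<lambda>x y. (x, y) \<in> E) (x # zs)"
      using xs(1) by (auto simp: split simple_path_def successively_append_iff)
    have hdl: "hd (ys @ [x]) = u" "last (x # zs) = v"
      using xs(1) by (auto simp: split simple_path_def hd_append)
    show ?thesis
    proof (cases "set (ys @ [x]) \<inter> Z = {}")
      case True
      then have "u \<rightarrow>\<^sup>*\<^bsub>G \<restriction> ?W\<^esub> x"
        using reachable_induce_path[OF succ(1), of ?W] sub hdl by (auto simp: split)
      moreover have "u \<notin> Z"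
        using True hdl(1) hd_in_set[of "ys @ [x]"] by auto
      ultimately show ?thesis
        using sym by blast
    next
      case False
      \<comment> \<open>The removed vertex occurs before \<open>x\<close>, hence by distinctness not
        after it.\<close>
      then have "set (x # zs) \<inter> Z = {}"
        using Z xs by (auto simp: split simple_path_def)
      moreover from this have "x \<rightarrow>\<^sup>*\<^bsub>G \<restriction> ?W\<^esub> v"
        using reachable_induce_path[OF succ(2), of ?W] sub hdl(2) by (auto simp: split)
      ultimately show ?thesis
        using hdl(2) last_in_set[of "x # zs"] by auto
    qed
  qed
  have all: "x \<rightarrow>\<^sup>*\<^bsub>G \<restriction> ?W\<^esub> y" if "x \<in> ?W" "y \<in> ?W" for x y
    using reach[OF that(1)] reach[OF that(2)] uv' sym W.reachable_trans by meson
  have "?W \<noteq> {}"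
    using Z ends ends_in_path_verts[OF uv] by auto
  then show ?thesis
    using all by (intro W.connectedI) (auto simp: W.reachable_mk_symmetric_eq[OF W.sym_arcs])
qed

lemma nonseparable_path_verts:
  assumes "(u, v) \<in> E"
  shows "nonseparable (G \<restriction> path_verts u v)"
proof -
  let ?W = "path_verts u v"
  have sub: "?W \<subseteq> verts G"
    using assms by (rule path_verts_subset)
  have "card {u, v} \<le> card ?W"
    using sub ends_in_path_verts[OF assms] by (intro card_mono finite_subset[OF sub]) auto
  moreover have "u \<noteq> v"
    using assms adj_not_same by auto
  then have "card {u, v} = 2"
    by simp
  moreover have "pre_digraph.del_vert (G \<restriction> ?W) z = G \<restriction> (?W - {z})" for z
    by (auto simp: pre_digraph.del_vert_def induce_subgraph_def)
  ultimately show ?thesis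
    using graph_induce[OF sub] connected_path_verts_minus[OF assms, of "{}"]
      connected_path_verts_minus[OF assms subset_refl]
    by (simp add: nonseparable_def)
qed

text \<open>By finiteness there is a largest nonseparable subgraph of \<open>G\<close> above
  \<open>H\<close>; a proper nonseparable extension would be larger still.\<close>

lemma nonseparable_subset_block:
  assumes "nonseparable H" "subgraph H G"
  obtains B where "is_block G B" "subgraph H B"
proof -
  define P where "P B \<longleftrightarrow> subgraph B G \<and> nonseparable B \<and> subgraph H B" for B
  \<comment> \<open>Arcs are counted too, because a proper subgraph may have the same vertices; this
    makes \<open>f\<close> strictly monotone.\<close>
  define f where "f B = card (verts B) + card (arcs B)" for B :: "('a, 'b) pre_digraph"
  have f_mono: "f B \<le> f B' \<and> (f B = f B' \<longrightarrow> B = B')" if "subgraph B B'" "subgraph B' G" for B B'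
  proof -
    have sub: "verts B \<subseteq> verts B'" "arcs B \<subseteq> arcs B'"
      and com: "tail B = tail B'" "head B = head B'"
      using that(1) by (auto simp: subgraph_def compatible_def)
    interpret B': fin_digraph B'
      using that(2) by (rule fin_digraph_subgraph)
    have fin: "finite (verts B')" "finite (arcs B')"
      by simp_all
    have le: "card (verts B) \<le> card (verts B')" "card (arcs B) \<le> card (arcs B')"
      using sub fin by (auto intro: card_mono)
    moreover have "B = B'" if "f B = f B'"
    proof -
      have "card (verts B) = card (verts B')" "card (arcs B) = card (arcs B')"
        using that le unfolding f_def by linarith+
      then have "verts B = verts B'" "arcs B = arcs B'"
        using sub fin by (metis card_subset_eq)+
      with com show ?thesis by (intro pre_digraph.equality) simp_all
    qed
    ultimately show ?thesis
      by (simp add: f_def add_mono)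
  qed
  have "wf_digraph H"
    using assms(2) by (simp add: subgraph_def)
  then have "P H"
    using assms by (simp add: P_def wf_digraph.subgraph_refl)
  moreover have "f B \<le> f G" if "P B" for B
    using f_mono[of B G] subgraph_refl that by (simp add: P_def)
  ultimately have "\<exists>B. P B \<and> (\<forall>B'. P B' \<longrightarrow> f B' \<le> f B)"
    by (intro ex_has_greatest_nat[of P H f "Suc (f G)"]) (simp_all add: le_imp_less_Suc)
  then obtain B where B: "P B" "\<And>B'. P B' \<Longrightarrow> f B' \<le> f B"
    by (elim exE conjE) simp
  have "is_block G B"
    unfolding is_block_def
  proof (rule max_subgraphI)
    fix B' assume B': "B \<noteq> B'" "subgraph B B'" "subgraph B' G"
    show "\<not> nonseparable B'"
    proof
      assume "nonseparable B'"
      moreover have "subgraph H B'"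
        using B(1) B'(2) unfolding P_def by (elim conjE) (rule subgraph_trans)
      ultimately have "P B'"
        using B'(3) by (simp add: P_def)
      then have "f B' \<le> f B"
        by (rule B(2))
      with f_mono[OF B'(2,3)] B'(1) show False by simp
    qed
  qed (use B(1) in \<open>simp_all add: P_def\<close>)
  moreover have "subgraph H B"
    using B(1) by (simp add: P_def)
  ultimately show thesis
    by (rule that)
qed

end

section \<open>Blocks and paths in a cactus\<close>

locale cactus_graph = connected_graph +
  assumes cactus: "cactus G"
begin

text \<open>A block has at least two vertices, which excludes the single-vertex alternative in
  \<open>cactus\<close>.\<close>

lemma block_cases:
  assumes "is_block G B"
  shows "is_edge_graph B \<or> is_cycle_graph B"
proof -
  have B: "subgraph B G" "nonseparable B"
    using assms by (auto simp: is_block_def max_subgraph_def)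
  then have "card (verts B) \<le> card (verts G)" "2 \<le> card (verts B)"
    by (auto simp: subgraph_def nonseparable_def intro: card_mono)
  then show ?thesis
    using cactus assms by (auto simp: cactus_def)
qed

text \<open>In an edge or a cycle every vertex lies on a simple path from \<open>u\<close> to
  \<open>v\<close>, so \<open>B\<close> is contained in the nonseparable graph on the right, and
  maximality gives equality.\<close>

lemma block_eq_path_verts:
  assumes B: "is_block G B" and uv: "(u, v) \<in> arcs_ends B"
  shows "B = G \<restriction> path_verts u v"
proof -
  have sub: "subgraph B G"
    using B by (auto simp: is_block_def max_subgraph_def)
  have E: "arcs_ends B \<subseteq> E"
    using sub by (rule arcs_ends_mono)
  have uvE: "(u, v) \<in> E"
    using uv E by auto
  have W: "path_verts u v \<subseteq> verts G"
    using uvE by (rule path_verts_subset)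
  have verts: "verts B \<subseteq> path_verts u v"
    using block_cases[OF B]
  proof
    assume "is_edge_graph B"
    then have "verts B = {u, v}"
      using uv by (auto simp: is_edge_graph_def)
    then show ?thesis
      using ends_in_path_verts[OF uvE] by auto
  next
    assume "is_cycle_graph B"
    then obtain xs where xs: "simple_path (arcs_ends B) u xs v" "set xs = verts B"
      using uv by (rule cycle_graph_path)
    then have "simple_path E u xs v"
      using E by (auto simp: simple_path_def elim: successively_mono)
    with xs(2) show ?thesis
      by (auto simp: path_verts_def)
  qed
  have "subgraph B (G \<restriction> verts B)"
    using sub by (rule subgraph_induce_subgraphI2)
  then have "subgraph B (G \<restriction> path_verts u v)"
    using verts by (auto simp: subgraph_def compatible_def)
  moreover have "subgraph (G \<restriction> path_verts u v) G"
    using W by (rule subgraph_induce_subgraphI)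
  ultimately show ?thesis
    using B nonseparable_path_verts[OF uvE] unfolding is_block_def max_subgraph_def by metis
qed

lemma is_block_path_verts:
  assumes "(u, v) \<in> E"
  shows "is_block G (G \<restriction> path_verts u v)"
proof -
  have "subgraph (G \<restriction> path_verts u v) G"
    using path_verts_subset[OF assms] by (rule subgraph_induce_subgraphI)
  then obtain B where B: "is_block G B" "subgraph (G \<restriction> path_verts u v) B"
    using nonseparable_path_verts[OF assms] nonseparable_subset_block by blast
  have "(u, v) \<in> arcs_ends (G \<restriction> path_verts u v)"
    using assms ends_in_path_verts[OF assms] by (simp add: arcs_ends_induce)
  then have "(u, v) \<in> arcs_ends B"
    using arcs_ends_mono[OF B(2)] by auto
  with B(1) show ?thesis
    using block_eq_path_verts by metis
qed

text \<open>All these paths run inside one block, whose degrees are at most two. Both leave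
  \<open>u\<close> by a neighbour other than \<open>v\<close>, hence by the same one, and from there
  the continuation is forced.\<close>

lemma unique_path:
  assumes uv: "(u, v) \<in> E"
    and xs: "simple_path E u xs v" "xs \<noteq> [u, v]"
    and ys: "simple_path E u ys v" "ys \<noteq> [u, v]"
  shows "xs = ys"
proof -
  let ?B = "G \<restriction> path_verts u v"
  have deg: "a = b \<or> a = c \<or> b = c"
    if "(x, a) \<in> arcs_ends ?B" "(x, b) \<in> arcs_ends ?B" "(x, c) \<in> arcs_ends ?B" for x a b c
    using block_cases[OF is_block_path_verts[OF uv]] cycle_graph_degree[OF _ that] that
    by (auto simp: is_edge_graph_def)
  have symB: "sym (arcs_ends ?B)"
    using sym_E by (auto simp: arcs_ends_induce sym_def)
  have "(u, v) \<in> arcs_ends ?B"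
    using uv ends_in_path_verts[OF uv] by (simp add: arcs_ends_induce)
  have in_B: "simple_path (arcs_ends ?B) u zs v" if "simple_path E u zs v" for zs
  proof -
    have "set zs \<subseteq> path_verts u v"
      using that by (auto simp: path_verts_def)
    then have "successively (\<lambda>x y. (x, y) \<in> arcs_ends ?B) zs"
      using that unfolding simple_path_def
      by (auto simp: arcs_ends_induce subset_iff intro!: successively_mono)
    with that show ?thesis
      by (simp add: simple_path_def)
  qed
  have decomp: "\<exists>a zs'. zs = u # a # zs' \<and> a \<noteq> v" if "simple_path E u zs v" "zs \<noteq> [u, v]" for zs
  proof -
    have "u \<noteq> v"
      using uv adj_not_same by auto
    with that obtain a zs' where zs: "zs = u # a # zs'"
      by (auto simp: simple_path_def neq_Nil_conv split: if_splits)
    have "zs' \<noteq> []"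
      using that zs by (auto simp: simple_path_def)
    then have "a \<noteq> v"
      using that(1) zs last_in_set[of zs'] by (auto simp: simple_path_def)
    with zs show ?thesis by simp
  qed
  obtain a xs' where a: "xs = u # a # xs'" "a \<noteq> v"
    using decomp[OF xs] by blast
  obtain b ys' where b: "ys = u # b # ys'" "b \<noteq> v"
    using decomp[OF ys] by blast
  note paths = in_B[OF xs(1)] in_B[OF ys(1)]
  have "a = b"
    using deg[OF \<open>(u, v) \<in> arcs_ends ?B\<close>, of a b] paths a b by (auto simp: simple_path_def)
  moreover have "xs' = ys'"
    using paths a b \<open>a = b\<close> unique_continuation[OF symB deg, where p = u and x = a and xs = xs' and ys = ys']
    by (auto simp: simple_path_def)
  ultimately show ?thesis
    using a b by simp
qed

end

section \<open>Counting edges separated by a pair of vertices\<close>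

context connected_graph
begin

text \<open>The set \<open>A x y\<close> of the overview. An edge contributes at most one of its two
  orientations.\<close>

definition sep_arcs :: "'a \<Rightarrow> 'a \<Rightarrow> ('a \<times> 'a) set" where
  "sep_arcs x y = {(s, t) \<in> E. x \<in> closer s t \<and> y \<in> closer t s}"

definition side :: "'a \<Rightarrow> 'a \<Rightarrow> 'a \<Rightarrow> int" where
  "side s t x = int (d x s) - int (d x t)"

text \<open>The l1 distance between the vectors of \<open>side\<close> values of \<open>x\<close>
  and \<open>y\<close>, hence subadditive.\<close>

definition side_variation :: "'a \<Rightarrow> 'a \<Rightarrow> int" where
  "side_variation x y = (\<Sum>(s, t)\<in>E. \<bar>side s t x - side s t y\<bar>)"

lemma finite_sep_arcs: "finite (sep_arcs x y)"
  using finite_E by (rule finite_subset[rotated]) (auto simp: sep_arcs_def)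

lemma side_cases:
  assumes "(s, t) \<in> E" "x \<in> verts G"
  shows "side s t x = -1 \<and> x \<in> closer s t \<and> x \<notin> closer t s \<or>
    side s t x = 0 \<and> x \<notin> closer s t \<and> x \<notin> closer t s \<or>
    side s t x = 1 \<and> x \<notin> closer s t \<and> x \<in> closer t s"
  using assms dist_adj_le[of s t x] dist_adj_le[of t s x] E_commute[of s t]
  by (auto simp: side_def closer_def)

lemma sum_szeged_eq:
  "(\<Sum>(s, t)\<in>E. num_closer G s t * num_closer G t s) =
    (\<Sum>x\<in>verts G. \<Sum>y\<in>verts G. card (sep_arcs x y))"
proof -
  have "(\<Sum>(s, t)\<in>E. num_closer G s t * num_closer G t s) =
      (\<Sum>p\<in>E. card (closer (fst p) (snd p) \<times> closer (snd p) (fst p)))"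
    by (simp add: num_closer_def closer_def card_cartesian_product case_prod_beta)
  \<comment> \<open>Both sums count the quadruples \<open>((s, t), (x, y))\<close>; the bijection
    exchanges the two pairs.\<close>
  also have "\<dots> = card (SIGMA p:E. closer (fst p) (snd p) \<times> closer (snd p) (fst p))"
    using finite_E by (simp add: card_SigmaI closer_def)
  also have "\<dots> = card (SIGMA q:verts G \<times> verts G. sep_arcs (fst q) (snd q))"
    by (rule bij_betw_same_card[of prod.swap])
      (auto simp: bij_betw_def inj_on_def sep_arcs_def closer_def image_iff)
  also have "\<dots> = (\<Sum>q\<in>verts G \<times> verts G. card (sep_arcs (fst q) (snd q)))"
    using finite_sep_arcs by (simp add: card_SigmaI)
  also have "\<dots> = (\<Sum>x\<in>verts G. \<Sum>y\<in>verts G. card (sep_arcs x y))"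
    by (simp add: sum.cartesian_product case_prod_beta)
  finally show ?thesis .
qed

lemma szeged_index_eq:
  "szeged_index G = (\<Sum>x\<in>verts G. \<Sum>y\<in>verts G. real (card (sep_arcs x y))) / 2"
  using arg_cong[OF sum_szeged_eq, of real]
  by (simp add: szeged_index_def case_prod_beta)

text \<open>
  Every arc in \<^term>\<open>sep_arcs x y\<close> contributes 2 to the variation, and so does its reversal.
\<close>
lemma sep_arcs_le_side_variation:
  assumes "x \<in> verts G" "y \<in> verts G"
  shows "4 * int (card (sep_arcs x y)) \<le> side_variation x y"
proof -
  let ?A = "sep_arcs x y" and ?f = "\<lambda>p. \<bar>side (fst p) (snd p) x - side (fst p) (snd p) y\<bar>"
  let ?A' = "prod.swap ` ?A"
  have f: "?f p = 2" if "p \<in> ?A" for p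
  proof -
    obtain s t where p: "p = (s, t)" "(s, t) \<in> E" "x \<in> closer s t" "y \<in> closer t s"
      using \<open>p \<in> ?A\<close> by (auto simp: sep_arcs_def)
    then have "side s t x = -1" "side s t y = 1"
      using side_cases[OF p(2) assms(1)] side_cases[OF p(2) assms(2)] by auto
    with p(1) show ?thesis by simp
  qed
  have f': "?f p = 2" if "p \<in> ?A'" for p
  proof -
    obtain s t where "p = (t, s)" "(s, t) \<in> ?A"
      using \<open>p \<in> ?A'\<close> by auto
    then show ?thesis
      using f[of "(s, t)"] by (simp add: side_def)
  qed
  have sub: "?A \<union> ?A' \<subseteq> E"
    using E_commute by (auto simp: sep_arcs_def)
  have "?A \<inter> ?A' = {}"
    by (auto simp: sep_arcs_def closer_def)
  then have "(\<Sum>p\<in>?A \<union> ?A'. ?f p) = (\<Sum>p\<in>?A. ?f p) + (\<Sum>p\<in>?A'. ?f p)"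
    using finite_sep_arcs by (intro sum.union_disjoint) auto
  also have "\<dots> = (\<Sum>p\<in>?A. 2) + (\<Sum>p\<in>?A'. 2)"
    using f f' by (intro arg_cong2[of _ _ _ _ "(+)"] sum.cong refl) auto
  also have "\<dots> = 4 * int (card ?A)"
    by (simp add: card_image)
  finally have "4 * int (card ?A) = (\<Sum>p\<in>?A \<union> ?A'. ?f p)" ..
  also have "\<dots> \<le> (\<Sum>p\<in>E. ?f p)"
    using sub finite_E by (intro sum_mono2) auto
  finally show ?thesis
    by (simp add: side_variation_def case_prod_beta)
qed

lemma side_variation_triangle:
  "side_variation x z \<le> side_variation x y + side_variation y z"
  unfolding side_variation_def sum.distrib[symmetric] case_prod_beta
  by (intro sum_mono) auto

text \<open>Symmetry of the distance turns a change between \<open>u\<close> and \<open>v\<close>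
  for the arc \<open>st\<close> into a change of \<open>side u v\<close> along \<open>st\<close>.
  That function is -1 on one half-space, 1 on the other and 0 elsewhere, so its jumps count boundary
  crossings.\<close>

lemma side_variation_adj:
  assumes uv: "(u, v) \<in> E"
  shows "side_variation u v =
    2 * int (card (edge_cut (closer u v))) + 2 * int (card (edge_cut (closer v u)))"
proof -
  \<comment> \<open>The sum over \<open>E\<close> meets each boundary edge in both orientations; the
    second form counts the incoming one.\<close>
  have ind: "int (card (edge_cut X)) = (\<Sum>(s, t)\<in>E. if s \<in> X \<and> t \<notin> X then 1 else 0)"
    "int (card (edge_cut X)) = (\<Sum>(s, t)\<in>E. if t \<in> X \<and> s \<notin> X then 1 else 0)" for X
  proof -
    show *: "int (card (edge_cut X)) = (\<Sum>(s, t)\<in>E. if s \<in> X \<and> t \<notin> X then 1 else 0)"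
    proof -
      have "edge_cut X = {p \<in> E. fst p \<in> X \<and> snd p \<notin> X}"
        by (auto simp: edge_cut_def)
      then show ?thesis
        using finite_E by (simp add: sum.If_cases case_prod_beta Int_def)
    qed
    also have "\<dots> = (\<Sum>(s, t)\<in>E. if t \<in> X \<and> s \<notin> X then 1 else 0)"
      by (rule sum.reindex_bij_witness[of _ prod.swap prod.swap]) (auto intro: E_commute)
    finally show "int (card (edge_cut X)) = (\<Sum>(s, t)\<in>E. if t \<in> X \<and> s \<notin> X then 1 else 0)" .
  qed
  let ?U = "closer u v" and ?V = "closer v u"
  have "side_variation u v = (\<Sum>(s, t)\<in>E.
      (if s \<in> ?U \<and> t \<notin> ?U then 1 else 0) + (if t \<in> ?U \<and> s \<notin> ?U then 1 else 0) +
      (if s \<in> ?V \<and> t \<notin> ?V then 1 else 0) + (if t \<in> ?V \<and> s \<notin> ?V then 1 else 0))"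
    unfolding side_variation_def
  proof (intro sum.cong refl, clarify)
    fix s t assume st: "(s, t) \<in> E"
    have V: "u \<in> verts G" "v \<in> verts G" "s \<in> verts G" "t \<in> verts G"
      using uv st adj_in_verts by auto
    have "side s t u - side s t v = side u v s - side u v t"
      using V by (simp add: side_def dist_commute)
    then show "\<bar>side s t u - side s t v\<bar> =
      (if s \<in> ?U \<and> t \<notin> ?U then 1 else 0) + (if t \<in> ?U \<and> s \<notin> ?U then 1 else 0) +
      (if s \<in> ?V \<and> t \<notin> ?V then 1 else 0) + (if t \<in> ?V \<and> s \<notin> ?V then 1 else 0)"
      using side_cases[OF uv V(3)] side_cases[OF uv V(4)] by auto
  qed
  also have "\<dots> = 2 * int (card (edge_cut ?U)) + 2 * int (card (edge_cut ?V))"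
    using ind[of ?U] ind[of ?V] by (simp add: sum.distrib case_prod_beta)
  finally show ?thesis .
qed

lemma edge_in_cut:
  assumes "(u, v) \<in> E"
  shows "(u, v) \<in> edge_cut (closer u v)"
  using assms adj_in_verts[OF assms] dist_adj[OF assms] by (auto simp: edge_cut_def closer_def)

lemma closer_disjoint: "closer u v \<inter> closer v u = {}"
  by (auto simp: closer_def)

text \<open>
  Symmetry of the Djokovic relation: an arc separates the ends of another arc iff conversely.
\<close>
lemma sep_arcs_adj_iff:
  assumes "(u, v) \<in> E" "(a, b) \<in> E"
  shows "(a, b) \<in> sep_arcs u v \<longleftrightarrow> a \<in> closer u v \<and> b \<in> closer v u"
proof -
  have V: "u \<in> verts G" "v \<in> verts G" "a \<in> verts G" "b \<in> verts G"
    using assms adj_in_verts by auto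
  \<comment> \<open>Either side of the equivalence turns these bounds into
    \<open>d a u = d b v\<close> and \<open>d a v = d b u = Suc (d a u)\<close>.\<close>
  have "d a u \<le> Suc (d a v)" "d a v \<le> Suc (d a u)" "d b u \<le> Suc (d b v)" "d b v \<le> Suc (d b u)"
    "d a u \<le> Suc (d b u)" "d b u \<le> Suc (d a u)" "d a v \<le> Suc (d b v)" "d b v \<le> Suc (d a v)"
    using dist_adj_le assms E_commute V by blast+
  then show ?thesis
    using assms(2) V dist_commute[of u] dist_commute[of v] by (auto simp: sep_arcs_def closer_def)
qed

end

section \<open>The inequality\<close>

context cactus_graph
begin

text \<open>Both edges yield a path from \<open>u\<close> to \<open>v\<close> other than
  \<open>uv\<close>, and there is only one. It meets the half-space in an initial segment, whose end
  marks the edge.\<close>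

lemma edge_cut_unique:
  assumes uv: "(u, v) \<in> E"
    and "(a, b) \<in> edge_cut (closer u v)" "(a, b) \<noteq> (u, v)"
    and "(a', b') \<in> edge_cut (closer u v)" "(a', b') \<noteq> (u, v)"
  shows "(a, b) = (a', b')"
proof -
  let ?U = "closer u v"
  obtain xs ys where 1: "simple_path E u (xs @ ys) v" "xs @ ys \<noteq> [u, v]"
      "last xs = a" "set xs \<subseteq> ?U" "hd ys = b" "set ys \<inter> ?U = {}"
    using uv assms(2,3) by (rule crossing_path)
  obtain xs' ys' where 2: "simple_path E u (xs' @ ys') v" "xs' @ ys' \<noteq> [u, v]"
      "last xs' = a'" "set xs' \<subseteq> ?U" "hd ys' = b'" "set ys' \<inter> ?U = {}"
    using uv assms(4,5) by (rule crossing_path)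
  have "xs @ ys = xs' @ ys'"
    using unique_path[OF uv] 1(1,2) 2(1,2) by blast
  \<comment> \<open>Filtering by the half-space recovers the two pieces from their
    concatenation.\<close>
  moreover have "filter (\<lambda>w. w \<in> ?U) (zs @ ws) = zs \<and> filter (\<lambda>w. w \<notin> ?U) (zs @ ws) = ws"
    if "set zs \<subseteq> ?U" "set ws \<inter> ?U = {}" for zs ws
  proof -
    have "filter (\<lambda>w. w \<in> ?U) zs = zs" "filter (\<lambda>w. w \<notin> ?U) ws = ws"
      using that by (auto intro!: filter_True)
    moreover have "filter (\<lambda>w. w \<in> ?U) ws = []" "filter (\<lambda>w. w \<notin> ?U) zs = []"
      using that by (auto intro!: filter_False)
    ultimately show ?thesis by simp
  qed
  ultimately have "xs = xs'" "ys = ys'"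
    using 1(4,6) 2(4,6) by metis+
  then show ?thesis
    using 1(3,5) 2(3,5) by simp
qed

lemma edge_cut_card_le:
  assumes uv: "(u, v) \<in> E"
  shows "card (edge_cut (closer u v)) \<le> 2"
proof (cases "edge_cut (closer u v) \<subseteq> {(u, v)}")
  case True
  then have "card (edge_cut (closer u v)) \<le> card {(u, v)}"
    by (intro card_mono) auto
  then show ?thesis by simp
next
  case False
  then obtain a b where "(a, b) \<in> edge_cut (closer u v)" "(a, b) \<noteq> (u, v)"
    by auto
  then have "edge_cut (closer u v) \<subseteq> {(u, v), (a, b)}"
    using edge_cut_unique[OF uv] by fastforce
  then have "card (edge_cut (closer u v)) \<le> card {(u, v), (a, b)}"
    by (intro card_mono) auto
  also have "\<dots> \<le> 2"
    by (simp add: card_insert_if)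
  finally show ?thesis .
qed

lemma side_variation_le:
  assumes "x \<in> verts G" "y \<in> verts G"
  shows "side_variation x y \<le> 8 * int (d x y)"
  using assms(2)
proof (induction "d x y" arbitrary: y rule: less_induct)
  case less
  show ?case
  proof (cases "x = y")
    case True
    then show ?thesis by (simp add: side_variation_def)
  next
    case False
    then obtain w where w: "(w, y) \<in> E" "d x y = Suc (d x w)"
      using assms(1) less.prems by (metis dist_predecessor)
    have "side_variation x w \<le> 8 * int (d x w)"
      using w adj_in_verts by (intro less.hyps) auto
    moreover have "side_variation w y \<le> 8"
      using side_variation_adj[OF w(1)] edge_cut_card_le[OF w(1)] edge_cut_card_le[OF E_commute[OF w(1)]]
      by linarith
    ultimately show ?thesis
      using side_variation_triangle[of x y w] w(2) by simp
  qed
qed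

lemma card_sep_arcs_le:
  assumes "x \<in> verts G" "y \<in> verts G"
  shows "card (sep_arcs x y) \<le> 2 * d x y"
  using sep_arcs_le_side_variation[OF assms] side_variation_le[OF assms] by linarith

lemma szeged_le_wiener: "szeged_index G \<le> 2 * wiener_index G"
proof -
  have "(\<Sum>x\<in>verts G. \<Sum>y\<in>verts G. real (card (sep_arcs x y))) \<le>
      (\<Sum>x\<in>verts G. \<Sum>y\<in>verts G. 2 * real (d x y))"
    using card_sep_arcs_le by (intro sum_mono) fastforce
  then show ?thesis
    by (simp add: szeged_index_eq wiener_index_def sum_distrib_left[symmetric])
qed

lemma szeged_eq_wiener_iff:
  "szeged_index G = 2 * wiener_index G \<longleftrightarrow>
    (\<forall>x\<in>verts G. \<forall>y\<in>verts G. card (sep_arcs x y) = 2 * d x y)"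
proof -
  let ?gap = "\<lambda>x y. 2 * real (d x y) - real (card (sep_arcs x y))"
  have nonneg: "0 \<le> ?gap x y" if "x \<in> verts G" "y \<in> verts G" for x y
    using card_sep_arcs_le[OF that] by simp
  have "szeged_index G = 2 * wiener_index G \<longleftrightarrow> (\<Sum>x\<in>verts G. \<Sum>y\<in>verts G. ?gap x y) = 0"
    by (auto simp: szeged_index_eq wiener_index_def sum_subtractf sum_distrib_left[symmetric])
  also have "\<dots> \<longleftrightarrow> (\<forall>x\<in>verts G. (\<Sum>y\<in>verts G. ?gap x y) = 0)"
    using nonneg by (intro sum_nonneg_eq_0_iff sum_nonneg) auto
  also have "\<dots> \<longleftrightarrow> (\<forall>x\<in>verts G. \<forall>y\<in>verts G. ?gap x y = 0)"
    using nonneg by (intro ball_cong refl sum_nonneg_eq_0_iff) auto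
  also have "\<dots> \<longleftrightarrow> (\<forall>x\<in>verts G. \<forall>y\<in>verts G. card (sep_arcs x y) = 2 * d x y)"
    by (intro ball_cong refl) auto
  finally show ?thesis .
qed

end

section \<open>The case of equality\<close>

lemma list_crossing:
  assumes "xs \<noteq> []" "hd xs \<in> X" "last xs \<notin> X"
  obtains ys zs where "xs = ys @ zs" "ys \<noteq> []" "zs \<noteq> []" "last ys \<in> X" "hd zs \<notin> X"
proof -
  have "\<exists>ys zs. xs = ys @ zs \<and> ys \<noteq> [] \<and> zs \<noteq> [] \<and> last ys \<in> X \<and> hd zs \<notin> X"
    using assms
  proof (induction xs rule: induct_list012)
    case (3 x y zs)
    show ?case
    proof (cases "y \<in> X")
      case True
      then obtain ys' zs' where "y # zs = ys' @ zs'" "ys' \<noteq> []" "zs' \<noteq> []" "last ys' \<in> X" "hd zs' \<notin> X"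
        using 3 by auto
      then show ?thesis
        by (intro exI[of _ "x # ys'"] exI[of _ zs']) simp
    next
      case False
      with 3 show ?thesis
        by (intro exI[of _ "[x]"] exI[of _ "y # zs"]) simp
    qed
  qed auto
  then show thesis using that by blast
qed

text \<open>Follow a geodesic from \<open>w\<close> back to \<open>x\<close> until it leaves
  \<open>X\<close>. The distance equation says that the crossing edge lies on a geodesic.\<close>

lemma (in connected_graph) metric_crossing:
  assumes "x \<in> verts G" "w \<in> verts G" "x \<notin> X" "w \<in> X"
  obtains p q where "(p, q) \<in> E" "p \<notin> X" "q \<in> X" "d x w = Suc (d x p + d q w)"
proof -
  have "\<exists>p q. (p, q) \<in> E \<and> p \<notin> X \<and> q \<in> X \<and> d x w = Suc (d x p + d q w)"
    using assms(2,4)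
  proof (induction "d x w" arbitrary: w rule: less_induct)
    case less
    then have "x \<noteq> w"
      using assms(3) by auto
    with assms(1) less.prems(1) obtain w' where w': "(w', w) \<in> E" "d x w = Suc (d x w')"
      by (rule dist_predecessor)
    have V: "w' \<in> verts G"
      using w'(1) by (rule adj_in_verts)
    show ?case
    proof (cases "w' \<in> X")
      case False
      with w' less.prems show ?thesis
        by (intro exI[of _ w'] exI[of _ w]) simp
    next
      case True
      then obtain p q where pq: "(p, q) \<in> E" "p \<notin> X" "q \<in> X" "d x w' = Suc (d x p + d q w')"
        using less.hyps[of w'] w' V by auto
      have q: "p \<in> verts G" "q \<in> verts G"
        using pq(1) by (rule adj_in_verts)+
      have "d q w \<le> Suc (d q w')"
        using dist_adj_le(1)[OF E_commute[OF w'(1)] q(2)] .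
      moreover have "d x w \<le> d x p + d p w"
        using assms(1) q(1) less.prems(1) by (rule dist_triangle)
      moreover have "d p w \<le> Suc (d q w)"
        using dist_adj_le(2)[OF pq(1) less.prems(1)] .
      ultimately have "d x w = Suc (d x p + d q w)"
        using w'(2) pq(4) by linarith
      with pq(1-3) show ?thesis by blast
    qed
  qed
  then show thesis using that by blast
qed

lemma (in connected_graph) sep_arcs_self: "x \<in> verts G \<Longrightarrow> sep_arcs x x = {}"
  using closer_disjoint by (auto simp: sep_arcs_def)

context cactus_graph
begin

lemma path_verts_eq:
  assumes "(u, v) \<in> E" "simple_path E u xs v" "xs \<noteq> [u, v]"
  shows "path_verts u v = set xs"
proof
  show "set xs \<subseteq> path_verts u v"
    using assms(2) by (auto simp: path_verts_def)
  have "w \<in> set xs" if "simple_path E u ys v" "w \<in> set ys" for w ys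
  proof (cases "ys = [u, v]")
    case True
    then show ?thesis
      using that(2) assms(2) hd_in_set[of xs] last_in_set[of xs] by (auto simp: simple_path_def)
  next
    case False
    then show ?thesis
      using unique_path[OF assms that(1)] that(2) by simp
  qed
  then show "path_verts u v \<subseteq> set xs"
    by (auto simp: path_verts_def)
qed

text \<open>Turns the parity of a block into the parity of a path length.\<close>

lemma card_path_verts:
  assumes "(u, v) \<in> E" "simple_path E u xs v" "xs \<noteq> [u, v]"
  shows "card (path_verts u v) = length xs"
  using path_verts_eq[OF assms] assms(2) by (simp add: simple_path_def distinct_card)

text \<open>Otherwise a geodesic from \<open>x\<close> to \<open>y\<close> would enter the
  half-space through \<open>pq\<close> and leave it through \<open>wy\<close>. Its boundary has at
  most one edge besides \<open>st\<close>, so one of the two is \<open>st\<close> or they coincide;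
  each case contradicts \<open>d x y > d x w\<close>.\<close>

lemma halfspace_gate:
  assumes bip: "\<And>u v z. (u, v) \<in> E \<Longrightarrow> z \<in> verts G \<Longrightarrow> d z u \<noteq> d z v"
    and wy: "(w, y) \<in> E" "d x y = Suc (d x w)" and x: "x \<in> verts G"
    and st: "(s, t) \<in> E" "w \<in> closer s t" "y \<notin> closer s t"
  shows "x \<in> closer s t"
proof (rule ccontr)
  assume nx: "x \<notin> closer s t"
  have V: "w \<in> verts G" "y \<in> verts G" "s \<in> verts G" "t \<in> verts G"
    using wy(1) st(1) adj_in_verts by auto
  obtain p q where pq: "(p, q) \<in> E" "p \<notin> closer s t" "q \<in> closer s t" "d x w = Suc (d x p + d q w)"
    using x V(1) nx st(2) by (rule metric_crossing)
  have qp: "(q, p) \<in> edge_cut (closer s t)"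
    using pq E_commute by (simp add: edge_cut_def)
  show False
  proof (cases "(q, p) = (s, t)")
    case True
    \<comment> \<open>Having entered from \<open>t\<close> to \<open>s\<close>, the route would be
      shortened by going from \<open>t\<close> to \<open>y\<close> directly.\<close>
    have "d y t < d y s"
      using st(3) V bip[OF st(1) V(2)] by (auto simp: closer_def)
    moreover have "d y s \<le> Suc (d w s)"
      using dist_adj_le(2)[OF E_commute[OF wy(1)] V(3)] .
    moreover have "d x y \<le> d x t + d t y"
      using x V(4,2) by (rule dist_triangle)
    moreover have "d x w = Suc (d x t + d s w)"
      using pq(4) True by simp
    ultimately show False
      using wy(2) dist_commute[OF V(1,3)] dist_commute[OF V(2,4)] by linarith
  next
    case False
    have wy_cut: "(w, y) \<in> edge_cut (closer s t)"
      using wy(1) st by (simp add: edge_cut_def)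
    show False
    proof (cases "(w, y) = (s, t)")
      case True
      then have "d x y \<le> d x w"
        using nx x by (auto simp: closer_def)
      with wy(2) show False by linarith
    next
      case neq: False
      have "p = y"
        using edge_cut_unique[OF st(1) qp False wy_cut neq] by simp
      with pq(4) have "d x y < d x w" by simp
      with wy(2) show False by linarith
    qed
  qed
qed

text \<open>For an equidistant \<open>w\<close> nearest to the edge, the geodesics to
  \<open>u\<close> and \<open>v\<close> meet only in \<open>w\<close>. Joined, they form a simple
  path with an odd number of vertices, which fills the block of \<open>uv\<close>.\<close>

lemma even_blocks_imp_bipartite:
  assumes even: "\<And>B. is_block G B \<Longrightarrow> is_cycle_graph B \<Longrightarrow> even (card (verts B))"
    and cyc: "\<And>B. is_block G B \<Longrightarrow> is_cycle_graph B"
    and uv: "(u, v) \<in> E" and w: "w \<in> verts G"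
  shows "d w u \<noteq> d w v"
  using w
proof (induction "d w u" arbitrary: w rule: less_induct)
  case less
  have V: "u \<in> verts G" "v \<in> verts G"
    using uv by (rule adj_in_verts)+
  have "u \<noteq> v"
    using uv adj_not_same by auto
  show ?case
  proof
    assume eq: "d w u = d w v"
    obtain xs where xs: "simple_path E u xs w" "length xs = Suc (d u w)"
      and xs': "\<And>z. z \<in> set xs \<Longrightarrow> z \<in> verts G \<and> d u z + d z w = d u w"
      using V(1) less.prems by (rule geodesic) blast
    obtain ys where ys: "simple_path E w ys v" "length ys = Suc (d w v)"
      and ys': "\<And>z. z \<in> set ys \<Longrightarrow> z \<in> verts G \<and> d w z + d z v = d w v"
      using less.prems V(2) by (rule geodesic) blast
    have "w \<noteq> v"
      using eq \<open>u \<noteq> v\<close> V dist_eq_0_iff by auto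
    obtain zs where zs: "ys = w # zs"
      using ys(1) by (cases ys) (auto simp: simple_path_def)
    with ys(1) \<open>w \<noteq> v\<close> have "zs \<noteq> []"
      by (auto simp: simple_path_def)
    have "z \<notin> set xs" if "z \<in> set zs" for z
    proof
      assume "z \<in> set xs"
      then have z: "z \<in> verts G" "d u z + d z w = d u w"
        using xs' by auto
      have "d w z + d z v = d w v"
        using ys' that zs by simp
      moreover have "z \<noteq> w"
        using that zs ys(1) by (auto simp: simple_path_def)
      then have "d z w \<noteq> 0"
        using dist_eq_0_iff[OF z(1) less.prems] by simp
      \<comment> \<open>A second common vertex would be equidistant as well, and nearer.\<close>
      ultimately have "d z u < d w u" "d z u = d z v"
        using z(2) eq dist_commute[OF V(1) z(1)] dist_commute[OF V(1) less.prems]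
          dist_commute[OF z(1) less.prems] by linarith+
      with less.hyps z(1) show False by blast
    qed
    moreover have "simple_path E (hd zs) zs v" "(w, hd zs) \<in> E"
      using ys(1) zs \<open>zs \<noteq> []\<close> by (auto simp: simple_path_def successively_Cons)
    ultimately have path: "simple_path E u (xs @ zs) v"
      using xs(1) by (intro simple_path_append) auto
    have len: "length (xs @ zs) = Suc (2 * d w u)"
    proof -
      have "length (xs @ zs) = Suc (d u w) + d w v"
        using xs(2) ys(2) zs by simp
      then show ?thesis
        using eq dist_commute[OF V(1) less.prems] by linarith
    qed
    then have "odd (length (xs @ zs))"
      by simp
    moreover from this have "xs @ zs \<noteq> [u, v]"
      by (metis even_numeral length_Cons list.size(3) numeral_2_eq_2)
    ultimately have "odd (card (verts (G \<restriction> path_verts u v)))"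
      using card_path_verts[OF uv path] by simp
    then show False
      using even cyc is_block_path_verts[OF uv] by blast
  qed
qed

text \<open>Besides \<open>uv\<close> itself, the path around the cycle must leave the half-space of
  \<open>u\<close> somewhere; without equidistant vertices it lands in that of \<open>v\<close>. The
  upper bound is already known.\<close>

lemma card_sep_arcs_adj:
  assumes cyc: "\<And>B. is_block G B \<Longrightarrow> is_cycle_graph B"
    and bip: "\<And>u v z. (u, v) \<in> E \<Longrightarrow> z \<in> verts G \<Longrightarrow> d z u \<noteq> d z v"
    and uv: "(u, v) \<in> E"
  shows "card (sep_arcs u v) = 2"
proof -
  have V: "u \<in> verts G" "v \<in> verts G"
    using uv by (rule adj_in_verts)+
  let ?B = "G \<restriction> path_verts u v"
  have cycle: "is_cycle_graph ?B"
    using cyc is_block_path_verts[OF uv] .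
  have "(u, v) \<in> arcs_ends ?B"
    using uv ends_in_path_verts[OF uv] by (simp add: arcs_ends_induce)
  with cycle obtain xs where xs: "simple_path (arcs_ends ?B) u xs v" "set xs = verts ?B"
    by (rule cycle_graph_path)
  have path: "simple_path E u xs v"
    using xs(1) by (auto simp: simple_path_def arcs_ends_induce elim: successively_mono)
  have "card (verts ?B) \<ge> 3"
    using cycle by (auto simp: is_cycle_graph_def distinct_card)
  then have "xs \<noteq> [u, v]"
    using xs(2) card_length[of xs] by auto
  have "v \<notin> closer u v" "u \<in> closer u v"
    using edge_in_cut[OF uv] by (auto simp: edge_cut_def)
  with path obtain ys zs where split: "xs = ys @ zs" "ys \<noteq> []" "zs \<noteq> []"
      "last ys \<in> closer u v" "hd zs \<notin> closer u v"
    using list_crossing[of xs "closer u v"] by (auto simp: simple_path_def)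
  have "(last ys, hd zs) \<in> E"
    using path split by (auto simp: simple_path_def successively_append_iff)
  moreover from this have "hd zs \<in> verts G"
    by (rule adj_in_verts)
  then have "hd zs \<in> closer v u"
    using split(5) bip[OF uv, of "hd zs"] by (auto simp: closer_def)
  ultimately have "(last ys, hd zs) \<in> sep_arcs u v"
    using sep_arcs_adj_iff[OF uv] split(4) by simp
  moreover have "(u, v) \<in> sep_arcs u v"
    using sep_arcs_adj_iff[OF uv uv] edge_in_cut[OF uv] edge_in_cut[OF E_commute[OF uv]]
    by (simp add: edge_cut_def)
  moreover have "(last ys, hd zs) \<noteq> (u, v)"
  proof
    assume "(last ys, hd zs) = (u, v)"
    \<comment> \<open>Distinct lists whose first and last entries agree are singletons, so the path
      would be the edge.\<close>
    then have "hd ys = last ys" "hd zs = last zs" "distinct ys" "distinct zs"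
      using path split by (auto simp: simple_path_def)
    then have "ys = [last ys]" "zs = [hd zs]"
      using split(2,3) by (metis distinct.simps(2) last.simps last_in_set list.collapse list.sel(1,3))+
    with \<open>(last ys, hd zs) = (u, v)\<close> split(1) \<open>xs \<noteq> [u, v]\<close> show False
      by (metis append_Cons append_Nil prod.inject)
  qed
  then have "card {(last ys, hd zs), (u, v)} = 2"
    by simp
  ultimately have "2 \<le> card (sep_arcs u v)"
    using card_mono[OF finite_sep_arcs, of "{(last ys, hd zs), (u, v)}" u v] by simp
  then show ?thesis
    using card_sep_arcs_le[OF V] dist_adj[OF uv] by simp
qed

text \<open>By \<open>halfspace_gate\<close>, extending a geodesic by the edge \<open>wy\<close>
  keeps the old separating arcs and adds the two that separate \<open>w\<close> from
  \<open>y\<close>.\<close>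

lemma card_sep_arcs_eq:
  assumes cyc: "\<And>B. is_block G B \<Longrightarrow> is_cycle_graph B"
    and bip: "\<And>u v z. (u, v) \<in> E \<Longrightarrow> z \<in> verts G \<Longrightarrow> d z u \<noteq> d z v"
    and x: "x \<in> verts G" and y: "y \<in> verts G"
  shows "card (sep_arcs x y) = 2 * d x y"
  using y
proof (induction "d x y" arbitrary: y rule: less_induct)
  case less
  show ?case
  proof (cases "x = y")
    case True
    with x show ?thesis by (simp add: sep_arcs_self)
  next
    case False
    with x less.prems obtain w where w: "(w, y) \<in> E" "d x y = Suc (d x w)"
      by (rule dist_predecessor)
    note gate = halfspace_gate[OF bip w x]
    have "sep_arcs x w \<subseteq> sep_arcs x y"
    proof clarify
      fix s t assume st: "(s, t) \<in> sep_arcs x w"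
      \<comment> \<open>The gate is applied to the reversed arc: if \<open>y\<close> had left the
        half-space of \<open>t\<close>, then \<open>x\<close> would lie in it.\<close>
      then have "(t, s) \<in> E" "w \<in> closer t s" "x \<notin> closer t s"
        using E_commute closer_disjoint[of s t] by (auto simp: sep_arcs_def)
      then have "y \<in> closer t s"
        using gate by blast
      with st show "(s, t) \<in> sep_arcs x y"
        by (simp add: sep_arcs_def)
    qed
    moreover have "sep_arcs w y \<subseteq> sep_arcs x y"
    proof clarify
      fix s t assume st: "(s, t) \<in> sep_arcs w y"
      then have "(s, t) \<in> E" "w \<in> closer s t" "y \<notin> closer s t"
        using closer_disjoint[of s t] by (auto simp: sep_arcs_def)
      then have "x \<in> closer s t"
        using gate by blast
      with st show "(s, t) \<in> sep_arcs x y"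
        by (simp add: sep_arcs_def)
    qed
    ultimately have "card (sep_arcs x w \<union> sep_arcs w y) \<le> card (sep_arcs x y)"
      using finite_sep_arcs by (intro card_mono) auto
    moreover have "sep_arcs x w \<inter> sep_arcs w y = {}"
      using closer_disjoint by (auto simp: sep_arcs_def)
    then have "card (sep_arcs x w \<union> sep_arcs w y) = card (sep_arcs x w) + card (sep_arcs w y)"
      using finite_sep_arcs by (intro card_Un_disjoint) auto
    moreover have "card (sep_arcs x w) = 2 * d x w"
      using w adj_in_verts(1)[OF w(1)] by (intro less.hyps) simp_all
    moreover have "card (sep_arcs w y) = 2"
      using cyc bip w(1) by (rule card_sep_arcs_adj)
    ultimately show ?thesis
      using card_sep_arcs_le[OF x less.prems] w(2) by simp
  qed
qed

text \<open>The second separating arc \<open>ab\<close> gives a path from \<open>u\<close> to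
  \<open>v\<close> other than the edge, and it spans the block. Since \<open>d u a = d b v\<close>,
  it has an even number of vertices.\<close>

lemma even_cycle_block:
  assumes eq: "\<And>u v. (u, v) \<in> E \<Longrightarrow> card (sep_arcs u v) = 2" and B: "is_block G B"
  shows "is_cycle_graph B \<and> even (card (verts B))"
proof -
  have "nonseparable B" "subgraph B G"
    using B by (auto simp: is_block_def max_subgraph_def)
  then interpret B: graph B
    by (simp add: nonseparable_def)
  have conn: "strongly_connected B" and "2 \<le> card (verts B)"
    using \<open>nonseparable B\<close> B.symmetric_connected_imp_strongly_connected[OF B.sym_arcs]
    by (auto simp: nonseparable_def)
  then obtain u y where uy: "u \<in> verts B" "y \<in> verts B" "u \<noteq> y"
    by (auto simp: card_le_Suc_iff numeral_2_eq_2)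
  then have "u \<rightarrow>\<^sup>*\<^bsub>B\<^esub> y"
    using conn by (simp add: strongly_connected_def)
  \<comment> \<open>A connected graph with two vertices has an arc: the first one of a walk from
    \<open>u\<close> to \<open>y\<close>.\<close>
  then obtain v where uvB: "(u, v) \<in> arcs_ends B"
    using uy(3) by (cases rule: B.converse_reachable_cases) auto
  have uv: "(u, v) \<in> E"
    using uvB arcs_ends_mono[OF \<open>subgraph B G\<close>] by auto
  have V: "u \<in> verts G" "v \<in> verts G"
    using uv by (rule adj_in_verts)+
  have verts: "verts B = path_verts u v"
    using block_eq_path_verts[OF B uvB] by (metis induce_subgraph_verts)
  have "\<not> sep_arcs u v \<subseteq> {(u, v)}"
  proof
    assume "sep_arcs u v \<subseteq> {(u, v)}"
    then have "card (sep_arcs u v) \<le> card {(u, v)}"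
      by (intro card_mono) auto
    with eq[OF uv] show False by simp
  qed
  then obtain a b where ab: "(a, b) \<in> sep_arcs u v" "(a, b) \<noteq> (u, v)"
    by auto
  have abE: "(a, b) \<in> E"
    using ab(1) by (simp add: sep_arcs_def)
  have a: "a \<in> closer u v" and b: "b \<in> closer v u"
    using ab(1) sep_arcs_adj_iff[OF uv abE] by auto
  then have "(a, b) \<in> edge_cut (closer u v)"
    using abE closer_disjoint by (auto simp: edge_cut_def)
  then obtain xs ys where path: "simple_path E u (xs @ ys) v" "xs @ ys \<noteq> [u, v]"
      and len: "length (xs @ ys) = d u a + d b v + 2"
    using crossing_path[OF uv _ ab(2)] by metis
  have abV: "a \<in> verts G" "b \<in> verts G"
    using abE by (rule adj_in_verts)+
  have "d a u < d a v" "d b v < d b u"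
    using a b by (auto simp: closer_def)
  moreover have "d a v \<le> Suc (d b v)" "d b u \<le> Suc (d a u)"
    using dist_adj_le(2)[OF abE V(2)] dist_adj_le(2)[OF E_commute[OF abE] V(1)] by auto
  \<comment> \<open>The bounds close up to \<open>d b u \<le> Suc (d a u) \<le> d a v \<le> Suc (d b
    v) \<le> d b u\<close>.\<close>
  ultimately have "d u a = d b v"
    using dist_commute[OF V(1) abV(1)] by linarith
  then have "even (length (xs @ ys))"
    unfolding len by simp
  moreover have card: "card (verts B) = length (xs @ ys)"
    using card_path_verts[OF uv path] verts by simp
  moreover have "\<not> is_edge_graph B"
  proof
    assume "is_edge_graph B"
    then have "length (xs @ ys) = 2"
      using card by (auto simp: is_edge_graph_def)
    then obtain p q where "xs @ ys = [p, q]"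
      by (metis (no_types) length_0_conv length_Suc_conv numeral_2_eq_2)
    with path show False
      by (simp add: simple_path_def)
  qed
  ultimately show ?thesis
    using block_cases[OF B] by simp
qed

text \<open>One direction uses the pointwise equality for adjacent pairs only; the other extends it
  from these to all pairs. For a single vertex there are no blocks and both indices vanish.\<close>

lemma szeged_eq_wiener_iff_even_blocks:
  "szeged_index G = 2 * wiener_index G \<longleftrightarrow>
    (\<forall>B. is_block G B \<longrightarrow> is_cycle_graph B \<and> even (card (verts B)))"
proof
  assume "szeged_index G = 2 * wiener_index G"
  then have "card (sep_arcs u v) = 2" if "(u, v) \<in> E" for u v
    using that dist_adj[OF that] adj_in_verts[OF that] by (simp add: szeged_eq_wiener_iff)
  then show "\<forall>B. is_block G B \<longrightarrow> is_cycle_graph B \<and> even (card (verts B))"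
    using even_cycle_block by blast
next
  assume *: "\<forall>B. is_block G B \<longrightarrow> is_cycle_graph B \<and> even (card (verts B))"
  then have "d z u \<noteq> d z v" if "(u, v) \<in> E" "z \<in> verts G" for u v z
    using that even_blocks_imp_bipartite by blast
  with * show "szeged_index G = 2 * wiener_index G"
    unfolding szeged_eq_wiener_iff by (intro ballI card_sep_arcs_eq) auto
qed

end

theorem theorem3p1:
  fixes G :: "('a, 'b) pre_digraph"
  assumes "graph G" and "cactus G"
  shows "szeged_index G \<le> 2 * wiener_index G \<and>
    (szeged_index G = 2 * wiener_index G \<longleftrightarrow>
      (\<forall>B. is_block G B \<longrightarrow> is_cycle_graph B \<and> even (card (verts B))))"
proof -
  interpret graph G
    by fact
  interpret cactus_graph G
    using assms(2) by unfold_locales (auto simp: cactus_def)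
  show ?thesis
    using szeged_le_wiener szeged_eq_wiener_iff_even_blocks by blast
qed

end
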